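(* Let $\mathcal{P}_1,\ldots,\mathcal{P}_m\subset\mathbb{R}^N$ be lattice polytopes such that each $\mathcal{P}_i$ has a lattice point in its relative interior and satisfies $\mathrm{int}(2\mathcal{P}_i)=\mathrm{int}(\mathcal{P}_i)+(\mathcal{P}_i\cap\mathbb{Z}^N)$. Then: (1) The Minkowski sum $\mathcal{P}_1+\cdots+\mathcal{P}_m$ is level of index $1$; (2) The Cayley sum $\mathcal{P}_1*\cdots*\mathcal{P}_m$ is level of index $m$.
   Context: A lattice polytope is a convex polytope with vertices in $\mathbb{Z}^N$; $t\mathcal{P}=\{t\mathbf{x}:\mathbf{x}\in\mathcal{P}\}$; sums of sets are Minkowski sums. For $A\subset\mathbb{R}^k$, $\mathrm{int}(A)$ is the relative interior of $A$ in its affine span. The Cayley sum is $\mathcal{P}_1*\cdots*\mathcal{P}_m=\mathrm{conv}(\{\mathbf{e}_1\}\times\mathcal{P}_1\cup\cdots\cup\{\mathbf{e}_m\}\times\mathcal{P}_m)\subset\mathbb{R}^m\times\mathbb{R}^N$, with $\mathbf{e}_i$ the standard unit vectors of $\mathbb{R}^m$. A lattice polytope $\mathcal{P}\subset\mathbb{R}^k$ is level of index $r$ if $r=\min\{t\in\mathbb{Z}_{>0}:\mathrm{int}(t\mathcal{P})\cap\mathbb{Z}^k\neq\emptyset\}$ and for every integer $n\ge r$, $\mathrm{int}(n\mathcal{P})\cap\mathbb{Z}^k=(\mathrm{int}(r\mathcal{P})\cap\mathbb{Z}^k)+((n-r)\mathcal{P}\cap\mathbb{Z}^k)$. *)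

theory Defs
  imports "HOL-Analysis.Analysis" "HOL-Library.Set_Algebras"
begin

text \<open>
  Minkowski sums are the operations \<open>+\<close> and \<open>\<Sum>\<close> that \<open>Set_Algebras\<close> puts on sets; the
  relative interior is the library's \<open>rel_interior\<close>.
\<close>

text \<open>
  The integer points are defined for every Euclidean space, since they are needed both in
  \<open>\<real>\<^sup>N\<close> and in \<open>\<real>\<^sup>m \<times> \<real>\<^sup>N\<close>. The coordinates are taken with respect to \<open>Basis\<close>, which is the
  standard basis in both cases, as the two lemmas below make explicit.
\<close>

definition lattice_points :: "'a::euclidean_space set" where
  "lattice_points = {x. \<forall>b\<in>Basis. x \<bullet> b \<in> \<int>}"

lemma lattice_points_vec_iff:
  fixes x :: "real ^ 'n"
  shows "x \<in> lattice_points \<longleftrightarrow> (\<forall>i. x $ i \<in> \<int>)"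
  by (auto simp: lattice_points_def Basis_vec_def inner_axis)

lemma lattice_points_Pair_iff:
  "(x, y) \<in> lattice_points \<longleftrightarrow> x \<in> lattice_points \<and> y \<in> lattice_points"
  by (simp add: lattice_points_def Basis_prod_def ball_Un)

definition lattice_polytope :: "'a::euclidean_space set \<Rightarrow> bool" where
  "lattice_polytope P \<longleftrightarrow> polytope P \<and> {v. v extreme_point_of P} \<subseteq> lattice_points"

definition dilate :: "nat \<Rightarrow> 'a::real_vector set \<Rightarrow> 'a set" where
  "dilate t P = (\<lambda>x. real t *\<^sub>R x) ` P"

definition cayley_sum :: "('m::finite \<Rightarrow> (real ^ 'n) set) \<Rightarrow> ((real ^ 'm) \<times> (real ^ 'n)) set" where
  "cayley_sum P = convex hull (\<Union>i. {axis i 1} \<times> P i)"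

text \<open>
  The first three conjuncts after \<open>lattice_polytope P\<close> say that the minimum defining the index
  exists and equals \<open>r\<close>; the subtraction \<open>n - r\<close> does not truncate because \<open>r \<le> n\<close>.
\<close>

definition level_of_index :: "'a::euclidean_space set \<Rightarrow> nat \<Rightarrow> bool" where
  "level_of_index P r \<longleftrightarrow>
     lattice_polytope P \<and>
     r > 0 \<and> rel_interior (dilate r P) \<inter> lattice_points \<noteq> {} \<and>
     (\<forall>t>0. rel_interior (dilate t P) \<inter> lattice_points \<noteq> {} \<longrightarrow> r \<le> t) \<and>
     (\<forall>n\<ge>r. rel_interior (dilate n P) \<inter> lattice_points =
       (rel_interior (dilate r P) \<inter> lattice_points) + (dilate (n - r) P \<inter> lattice_points))"

end

theory Submission
  imports Defs
begin

text \<open>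
  For \<open>x = (k + 2) u\<close> with \<open>u\<close> relatively interior to \<open>P\<^sub>i\<close>, applying the hypothesis to \<open>2 u\<close> splits a
  lattice point of \<open>P\<^sub>i\<close> off \<open>x\<close> and leaves a relatively interior point of \<open>(k + 1) P\<^sub>i\<close>. By induction
  every relatively interior point of \<open>n P\<^sub>i\<close> is a relatively interior point of \<open>P\<^sub>i\<close> plus a lattice
  point of \<open>(n - 1) P\<^sub>i\<close>. A relatively interior point of a dilated Minkowski or Cayley sum is a sum of
  relatively interior points of dilates of the \<open>P\<^sub>i\<close>; in the Cayley case the dilation factors are
  its first \<open>m\<close> coordinates, which are positive integers for a lattice point. Splitting each summand
  gives the decomposition, whose first part is a lattice point because the other two points are.
\<close>

section \<open>Integer points and lattice polytopes\<close>

lemma lattice_points_add: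
  "x \<in> lattice_points \<Longrightarrow> y \<in> lattice_points \<Longrightarrow> x + y \<in> lattice_points"
  by (simp add: lattice_points_def inner_add_left)

lemma lattice_points_diff:
  "x \<in> lattice_points \<Longrightarrow> y \<in> lattice_points \<Longrightarrow> x - y \<in> lattice_points"
  by (simp add: lattice_points_def inner_diff_left)

lemma zero_lattice_points: "0 \<in> lattice_points"
  by (simp add: lattice_points_def)

lemma lattice_points_sum:
  "(\<And>i. i \<in> I \<Longrightarrow> f i \<in> lattice_points) \<Longrightarrow> sum f I \<in> lattice_points"
  by (induction I rule: infinite_finite_induct) (auto simp: zero_lattice_points lattice_points_add)

lemma axis_lattice_points: "axis i 1 \<in> (lattice_points :: (real ^ 'n) set)"
  by (simp add: lattice_points_vec_iff axis_def)

text \<open>One direction is Krein-Milman; for the other, extreme points of a hull lie in its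
  generating set. Any finite integral generating set will do, so the extreme points of Minkowski and
  Cayley sums need not be determined.\<close>

lemma lattice_polytope_iff_convex_hull:
  "lattice_polytope P \<longleftrightarrow> (\<exists>V. finite V \<and> V \<subseteq> lattice_points \<and> P = convex hull V)"
proof
  assume P: "lattice_polytope P"
  let ?V = "{v. v extreme_point_of P}"
  have "P = convex hull ?V"
    using P Krein_Milman_Minkowski polytope_imp_compact polytope_imp_convex
    unfolding lattice_polytope_def by blast
  moreover have "finite ?V"
    using P by (simp add: lattice_polytope_def finite_polyhedron_extreme_points polytope_imp_polyhedron)
  ultimately show "\<exists>V. finite V \<and> V \<subseteq> lattice_points \<and> P = convex hull V"
    using P unfolding lattice_polytope_def by blast
next
  assume "\<exists>V. finite V \<and> V \<subseteq> lattice_points \<and> P = convex hull V"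
  then show "lattice_polytope P"
    unfolding lattice_polytope_def
    using polytope_convex_hull extreme_point_of_convex_hull by blast
qed

lemma lattice_polytope_imp_convex: "lattice_polytope P \<Longrightarrow> convex P"
  by (simp add: lattice_polytope_def polytope_imp_convex)

lemma lattice_polytope_sum:
  fixes P :: "'i \<Rightarrow> 'a::euclidean_space set"
  assumes "finite I" "\<And>i. i \<in> I \<Longrightarrow> lattice_polytope (P i)"
  shows "lattice_polytope (\<Sum>i\<in>I. P i)"
proof -
  obtain V where V: "\<And>i. i \<in> I \<Longrightarrow> finite (V i) \<and> V i \<subseteq> lattice_points \<and> P i = convex hull V i"
    using assms(2) unfolding lattice_polytope_iff_convex_hull by metis
  \<comment> \<open>Taking convex hulls commutes with Minkowski sums.\<close>
  have "(\<Sum>i\<in>I. P i) = convex hull (\<Sum>i\<in>I. V i)"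
    using V by (simp add: convex_hull_set_sum)
  moreover have "finite (\<Sum>i\<in>I. V i)"
    using V by (intro finite_set_sum) auto
  moreover have "(\<Sum>i\<in>I. V i) \<subseteq> lattice_points"
    using V by (force simp: set_sum_alt[OF assms(1)] intro!: lattice_points_sum)
  ultimately show ?thesis
    unfolding lattice_polytope_iff_convex_hull by blast
qed

lemma lattice_polytope_cayley_sum:
  fixes P :: "'m::finite \<Rightarrow> (real ^ 'n) set"
  assumes "\<And>i. lattice_polytope (P i)"
  shows "lattice_polytope (cayley_sum P)"
proof -
  obtain V where V: "\<And>i. finite (V i) \<and> V i \<subseteq> lattice_points \<and> P i = convex hull V i"
    using assms unfolding lattice_polytope_iff_convex_hull by metis
  let ?W = "\<Union>i. {axis i 1 :: real ^ 'm} \<times> V i"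
  have "{axis i 1 :: real ^ 'm} \<times> P i \<subseteq> convex hull ?W" for i
  proof -
    \<comment> \<open>A singleton is its own hull, and hulls commute with products.\<close>
    have "{axis i 1 :: real ^ 'm} \<times> P i = convex hull ({axis i 1} \<times> V i)"
      using V by (simp add: convex_hull_Times)
    also have "\<dots> \<subseteq> convex hull ?W"
      by (intro hull_mono) auto
    finally show ?thesis .
  qed
  then have "cayley_sum P \<subseteq> convex hull ?W"
    unfolding cayley_sum_def by (intro hull_minimal) auto
  moreover have "convex hull ?W \<subseteq> cayley_sum P"
    unfolding cayley_sum_def using V by (intro hull_mono) (auto intro: hull_inc)
  moreover have "finite ?W"
    using V by auto
  moreover have "?W \<subseteq> lattice_points"
    using V by (fastforce simp: lattice_points_Pair_iff axis_lattice_points)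
  ultimately show ?thesis
    unfolding lattice_polytope_iff_convex_hull by blast
qed

section \<open>Dilates of convex sets and their relative interiors\<close>

lemma dilate_Suc_0 [simp]: "dilate (Suc 0) C = C"
  by (simp add: dilate_def)

lemma zero_in_dilate_0: "C \<noteq> {} \<Longrightarrow> 0 \<in> dilate 0 C"
  by (auto simp: dilate_def)

lemma rel_interior_dilate:
  fixes C :: "'a::euclidean_space set"
  shows "t > 0 \<Longrightarrow> rel_interior (dilate t C) = dilate t (rel_interior C)"
  unfolding dilate_def by (rule rel_interior_scaleR[symmetric]) simp

text \<open>Unless \<open>a + b = 0\<close>, dividing by \<open>a + b\<close> turns
  \<open>x + y\<close> into a convex combination of points of \<open>C\<close> with weights
  \<open>a / (a + b)\<close> and \<open>b / (a + b)\<close>.\<close>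

lemma dilate_add:
  assumes "convex C" "x \<in> dilate a C" "y \<in> dilate b C"
  shows "x + y \<in> dilate (a + b) C"
proof (cases "a + b = 0")
  case False
  obtain u w where u: "u \<in> C" "x = real a *\<^sub>R u" and w: "w \<in> C" "y = real b *\<^sub>R w"
    using assms(2,3) by (auto simp: dilate_def)
  define s where "s = real (a + b)"
  have s: "s > 0" "s = real a + real b"
    using False unfolding s_def by (simp_all only: of_nat_0_less_iff of_nat_add neq0_conv)
  have "(real a / s) *\<^sub>R u + (real b / s) *\<^sub>R w \<in> C"
    using s(1) u w assms(1)
    by (intro convexD) (auto simp: add_divide_distrib[symmetric] s(2)[symmetric])
  moreover have "x + y = real (a + b) *\<^sub>R ((real a / s) *\<^sub>R u + (real b / s) *\<^sub>R w)"
    using s(1) u w unfolding s_def[symmetric] by (simp add: scaleR_add_right)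
  ultimately show ?thesis
    unfolding dilate_def by blast
qed (use assms in \<open>auto simp: dilate_def\<close>)

lemma dilate_sum:
  assumes "convex C" "C \<noteq> {}" "\<And>i. i \<in> I \<Longrightarrow> x i \<in> dilate (k i) C"
  shows "(\<Sum>i\<in>I. x i) \<in> dilate (\<Sum>i\<in>I. k i) C"
  using assms(3)
  by (induction I rule: infinite_finite_induct)
    (auto simp: zero_in_dilate_0[OF assms(2)] dilate_add[OF assms(1)])

lemma rel_interior_dilate_add:
  fixes C :: "'a::euclidean_space set"
  assumes "convex C" "a > 0" "x \<in> rel_interior (dilate a C)" "y \<in> dilate b C"
  shows "x + y \<in> rel_interior (dilate (a + b) C)"
proof -
  obtain u where u: "u \<in> rel_interior C" "x = real a *\<^sub>R u"
    using assms(2,3) by (auto simp: rel_interior_dilate) (auto simp: dilate_def)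
  obtain w where w: "w \<in> C" "y = real b *\<^sub>R w"
    using assms(4) by (auto simp: dilate_def)
  \<comment> \<open>After division by \<open>a + b\<close> the sum lies on the segment from
    \<open>w\<close> in \<open>C\<close> to the relatively interior point \<open>u\<close>. As
    \<open>a > 0\<close>, it differs from \<open>w\<close>, so it is relatively interior.\<close>
  let ?e = "real a / real (a + b)"
  have "w - ?e *\<^sub>R (w - u) \<in> rel_interior C"
    using assms u w by (intro rel_interior_convex_shrink) (auto simp: field_simps)
  moreover have "x + y = real (a + b) *\<^sub>R (w - ?e *\<^sub>R (w - u))"
    using assms(2) u w by (simp add: scaleR_diff_right scaleR_add_left)
  ultimately show ?thesis
    using assms(2) by (auto simp: rel_interior_dilate) (auto simp: dilate_def)
qed

text \<open>For convex \<open>C\<close> and \<open>r > 0\<close> the inclusion from right to left is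
  automatic, and \<open>y\<close> is integral as the difference of \<open>x\<close> and
  \<open>x - y\<close>. So only a relatively interior \<open>y\<close> with integral remainder has
  to be supplied.\<close>

lemma level_of_indexI:
  fixes C :: "'a::euclidean_space set"
  assumes C: "lattice_polytope C" and r: "r > 0"
    and ne: "rel_interior (dilate r C) \<inter> lattice_points \<noteq> {}"
    and least: "\<And>t x. t > 0 \<Longrightarrow> x \<in> rel_interior (dilate t C) \<Longrightarrow> x \<in> lattice_points \<Longrightarrow> r \<le> t"
    and split: "\<And>n x. r \<le> n \<Longrightarrow> x \<in> rel_interior (dilate n C) \<Longrightarrow> x \<in> lattice_points \<Longrightarrow>
      \<exists>y\<in>rel_interior (dilate r C). x - y \<in> dilate (n - r) C \<inter> lattice_points"
  shows "level_of_index C r"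
  unfolding level_of_index_def
proof (intro conjI allI impI)
  fix n assume n: "r \<le> n"
  show "rel_interior (dilate n C) \<inter> lattice_points =
    (rel_interior (dilate r C) \<inter> lattice_points) + (dilate (n - r) C \<inter> lattice_points)"
    (is "?L = ?A + ?B")
  proof
    show "?L \<subseteq> ?A + ?B"
    proof
      fix x assume x: "x \<in> ?L"
      then obtain y where y: "y \<in> rel_interior (dilate r C)" "x - y \<in> ?B"
        using split[OF n] by blast
      moreover have "y \<in> lattice_points"
        using x y(2) lattice_points_diff[of x "x - y"] by simp
      ultimately have "y + (x - y) \<in> ?A + ?B"
        by blast
      then show "x \<in> ?A + ?B"
        by simp
    qed
    show "?A + ?B \<subseteq> ?L"
      using rel_interior_dilate_add[OF lattice_polytope_imp_convex[OF C] r, of _ _ "n - r"] n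
      by (auto elim!: set_plus_elim simp: lattice_points_add)
  qed
qed (use assms in blast)+

section \<open>Splitting relatively interior points of dilates\<close>

lemma rel_interior_dilate_split:
  fixes P :: "'a::euclidean_space set"
  assumes P: "convex P"
    and two: "rel_interior (dilate 2 P) = rel_interior P + (P \<inter> lattice_points)"
    and x: "x \<in> rel_interior (dilate (Suc k) P)"
  shows "\<exists>y\<in>rel_interior P. x - y \<in> dilate k P \<inter> lattice_points"
  using x
proof (induction k arbitrary: x)
  case 0
  then have "x \<in> rel_interior P"
    by simp
  moreover have "0 \<in> dilate 0 P"
    using calculation rel_interior_subset by (intro zero_in_dilate_0) blast
  ultimately show ?case
    by (intro bexI[of _ x]) (auto simp: zero_lattice_points)
next
  case (Suc k)
  obtain u where u: "u \<in> rel_interior P" "x = real (Suc (Suc k)) *\<^sub>R u"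
    using Suc.prems unfolding rel_interior_dilate[OF zero_less_Suc] by (auto simp: dilate_def)
  have "2 *\<^sub>R u \<in> rel_interior (dilate 2 P)"
    using u(1) by (simp add: rel_interior_dilate) (simp add: dilate_def)
  then obtain z v where zv: "z \<in> rel_interior P" "v \<in> P" "v \<in> lattice_points" "2 *\<^sub>R u = z + v"
    unfolding two by (auto elim!: set_plus_elim)
  have "real k *\<^sub>R u \<in> dilate k P"
    using u(1) rel_interior_subset unfolding dilate_def by blast
  \<comment> \<open>This point is \<open>x - v\<close>. It need not be integral even when
    \<open>x\<close> is, which is why the induction runs over all relatively interior
    points.\<close>
  then have "z + real k *\<^sub>R u \<in> rel_interior (dilate (Suc k) P)"
    using rel_interior_dilate_add[OF P, of 1 z "real k *\<^sub>R u" k] zv(1) by simp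
  then obtain y where y: "y \<in> rel_interior P"
    "z + real k *\<^sub>R u - y \<in> dilate k P" "z + real k *\<^sub>R u - y \<in> lattice_points"
    using Suc.IH by blast
  have "x = 2 *\<^sub>R u + real k *\<^sub>R u"
    by (simp add: u(2) scaleR_add_left[symmetric])
  then have eq: "x - y = (z + real k *\<^sub>R u - y) + v"
    by (simp add: zv(4))
  have "x - y \<in> dilate (Suc k) P"
    using dilate_add[OF P y(2), of v 1] zv(2) by (simp add: eq)
  moreover have "x - y \<in> lattice_points"
    unfolding eq by (intro lattice_points_add y zv)
  ultimately show ?case
    using y(1) by blast
qed

section \<open>The Minkowski sum\<close>

lemma level_of_index_sum:
  fixes P :: "'i \<Rightarrow> 'a::euclidean_space set"
  assumes I: "finite I"
    and P: "\<And>i. i \<in> I \<Longrightarrow> lattice_polytope (P i)"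
    and ne: "\<And>i. i \<in> I \<Longrightarrow> rel_interior (P i) \<inter> lattice_points \<noteq> {}"
    and two: "\<And>i. i \<in> I \<Longrightarrow> rel_interior (dilate 2 (P i)) = rel_interior (P i) + (P i \<inter> lattice_points)"
  shows "level_of_index (\<Sum>i\<in>I. P i) 1"
proof (rule level_of_indexI)
  have cvx: "convex (P i)" if "i \<in> I" for i
    using P[OF that] by (rule lattice_polytope_imp_convex)
  \<comment> \<open>Relative interiors of convex sets commute with finite Minkowski sums.\<close>
  have ri: "rel_interior (\<Sum>i\<in>I. P i) = {sum s I |s. \<forall>i\<in>I. s i \<in> rel_interior (P i)}"
    by (subst rel_interior_sum_gen[OF cvx]) (simp_all add: set_sum_alt[OF I])
  show "lattice_polytope (\<Sum>i\<in>I. P i)"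
    by (rule lattice_polytope_sum[OF I P])
  obtain s where "\<And>i. i \<in> I \<Longrightarrow> s i \<in> rel_interior (P i) \<inter> lattice_points"
    using ne unfolding ex_in_conv[symmetric] by metis
  then have "sum s I \<in> rel_interior (\<Sum>i\<in>I. P i) \<inter> lattice_points"
    unfolding ri by (auto intro: lattice_points_sum)
  then show "rel_interior (dilate 1 (\<Sum>i\<in>I. P i)) \<inter> lattice_points \<noteq> {}"
    by auto
  fix n :: nat and x
  assume n: "1 \<le> n" and x: "x \<in> rel_interior (dilate n (\<Sum>i\<in>I. P i))"
  obtain k where k: "n = Suc k"
    using n by (cases n) auto
  obtain s where s: "\<And>i. i \<in> I \<Longrightarrow> s i \<in> rel_interior (P i)" and xs: "x = real n *\<^sub>R sum s I"
    using x unfolding k rel_interior_dilate[OF zero_less_Suc] ri by (auto simp: dilate_def)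
  \<comment> \<open>The individual summands \<open>n s_i\<close> of an integral \<open>x\<close>
    need not be integral; splitting applies to them all the same.\<close>
  have "\<exists>y\<in>rel_interior (P i). real n *\<^sub>R s i - y \<in> dilate k (P i) \<inter> lattice_points" if "i \<in> I" for i
  proof (rule rel_interior_dilate_split[OF cvx[OF that] two[OF that]])
    show "real n *\<^sub>R s i \<in> rel_interior (dilate (Suc k) (P i))"
      using s[OF that] unfolding k rel_interior_dilate[OF zero_less_Suc] unfolding dilate_def by blast
  qed
  then obtain y where y: "\<And>i. i \<in> I \<Longrightarrow> y i \<in> rel_interior (P i) \<and>
      real n *\<^sub>R s i - y i \<in> dilate k (P i) \<and> real n *\<^sub>R s i - y i \<in> lattice_points"
    by (metis IntE)
  \<comment> \<open>All remainders carry the same factor \<open>k\<close>, so their sum is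
    \<open>k\<close> times a point of the Minkowski sum.\<close>
  then obtain p where p: "\<And>i. i \<in> I \<Longrightarrow> p i \<in> P i \<and> real n *\<^sub>R s i - y i = real k *\<^sub>R p i"
    unfolding dilate_def image_iff by metis
  have eq: "x - sum y I = (\<Sum>i\<in>I. real n *\<^sub>R s i - y i)"
    by (simp add: xs sum_subtractf scaleR_sum_right)
  have "x - sum y I = real k *\<^sub>R sum p I"
    using p by (simp add: eq scaleR_sum_right)
  moreover have "sum p I \<in> (\<Sum>i\<in>I. P i)"
    using p by (auto simp: set_sum_alt[OF I])
  ultimately have "x - sum y I \<in> dilate (n - 1) (\<Sum>i\<in>I. P i)"
    by (auto simp: k dilate_def)
  moreover have "x - sum y I \<in> lattice_points"
    unfolding eq using y by (intro lattice_points_sum) blast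
  moreover have "sum y I \<in> rel_interior (dilate 1 (\<Sum>i\<in>I. P i))"
    using y by (auto simp: ri)
  ultimately show "\<exists>y\<in>rel_interior (dilate 1 (\<Sum>i\<in>I. P i)).
      x - y \<in> dilate (n - 1) (\<Sum>i\<in>I. P i) \<inter> lattice_points"
    by blast
qed auto

section \<open>The Cayley sum\<close>

lemma sum_scaleR_axis: "(\<Sum>i\<in>UNIV. c i *\<^sub>R axis i (1::real)) = (\<chi> i::'m::finite. c i)"
  by (simp add: vec_eq_iff axis_def if_distrib[where f="\<lambda>x. _ * x"] cong: if_cong)

text \<open>The relative interior of the hull of a finite union of nonempty convex sets consists of
  the convex combinations, with all weights positive, of relatively interior points. The unit
  vectors record these weights in the first block of coordinates; dilation multiplies them by
  \<open>t\<close>.\<close>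

lemma rel_interior_dilate_cayley_sum:
  fixes P :: "'m::finite \<Rightarrow> (real ^ 'n) set"
  assumes "\<And>i. convex (P i)" "\<And>i. P i \<noteq> {}" and t: "t > 0"
  shows "rel_interior (dilate t (cayley_sum P)) =
    {((\<chi> i. a i), \<Sum>i\<in>UNIV. a i *\<^sub>R s i) |a s.
      (\<forall>i. a i > 0) \<and> (\<Sum>i\<in>UNIV. a i) = real t \<and> (\<forall>i. s i \<in> rel_interior (P i))}"
    (is "_ = ?R")
proof -
  have ri: "rel_interior (cayley_sum P) =
    {\<Sum>i\<in>UNIV. c i *\<^sub>R s i |c s. (\<forall>i. c i > 0) \<and> sum c UNIV = 1 \<and>
      (\<forall>i. s i \<in> {axis i 1} \<times> rel_interior (P i))}"
    unfolding cayley_sum_def using assms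
    by (subst rel_interior_convex_hull_union) (auto simp: convex_Times rel_interior_Times)
  show ?thesis
  proof
    show "rel_interior (dilate t (cayley_sum P)) \<subseteq> ?R"
    proof
      fix x assume "x \<in> rel_interior (dilate t (cayley_sum P))"
      then obtain z where z: "z \<in> rel_interior (cayley_sum P)" "x = real t *\<^sub>R z"
        unfolding rel_interior_dilate[OF t] unfolding dilate_def by blast
      then obtain c s where c: "\<And>i. c i > 0" "sum c UNIV = 1"
        and s: "\<And>i. s i \<in> {axis i 1} \<times> rel_interior (P i)"
        and x: "x = real t *\<^sub>R (\<Sum>i\<in>UNIV. c i *\<^sub>R s i)"
        unfolding ri by blast
      have fs: "fst (s i) = axis i 1" "snd (s i) \<in> rel_interior (P i)" for i
        using s[of i] by auto
      let ?a = "\<lambda>i. real t * c i"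
      have "x = ((\<chi> i. ?a i), \<Sum>i\<in>UNIV. ?a i *\<^sub>R snd (s i))"
        unfolding sum_scaleR_axis[symmetric]
        by (simp add: x prod_eq_iff fst_sum snd_sum fs scaleR_sum_right)
      moreover have "sum ?a UNIV = real t"
        by (simp add: c sum_distrib_left[symmetric])
      ultimately show "x \<in> ?R"
        using c t fs by (intro CollectI exI[of _ ?a] exI[of _ "\<lambda>i. snd (s i)"]) auto
    qed
    show "?R \<subseteq> rel_interior (dilate t (cayley_sum P))"
    proof
      fix x assume "x \<in> ?R"
      then obtain a s where a: "\<And>i. a i > 0" "(\<Sum>i\<in>UNIV. a i) = real t"
        and s: "\<And>i. s i \<in> rel_interior (P i)" and x: "x = ((\<chi> i. a i), \<Sum>i\<in>UNIV. a i *\<^sub>R s i)"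
        by blast
      have "x = real t *\<^sub>R (\<Sum>i\<in>UNIV. (a i / real t) *\<^sub>R (axis i 1, s i))"
        using t unfolding x sum_scaleR_axis[symmetric]
        by (simp add: prod_eq_iff fst_sum snd_sum scaleR_sum_right)
      moreover have "(\<Sum>i\<in>UNIV. (a i / real t) *\<^sub>R (axis i 1, s i)) \<in> rel_interior (cayley_sum P)"
        unfolding ri using t a s
        by (intro CollectI exI[of _ "\<lambda>i. a i / real t"] exI[of _ "\<lambda>i. (axis i 1, s i)"])
          (auto simp: sum_divide_distrib[symmetric])
      ultimately show "x \<in> rel_interior (dilate t (cayley_sum P))"
        unfolding rel_interior_dilate[OF t] unfolding dilate_def by blast
    qed
  qed
qed

text \<open>The weights are coordinates of \<open>x\<close>, hence positive integers. Writing them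
  as \<open>Suc (k i)\<close> isolates what remains after removing one copy of each
  \<open>P i\<close>, and shows that \<open>t\<close> is at least the number of polytopes.\<close>

lemma rel_interior_dilate_cayley_sum_latticeE:
  fixes P :: "'m::finite \<Rightarrow> (real ^ 'n) set"
  assumes "\<And>i. convex (P i)" "\<And>i. P i \<noteq> {}" "t > 0"
    and "x \<in> rel_interior (dilate t (cayley_sum P))" "x \<in> lattice_points"
  obtains k s where "t = (\<Sum>i\<in>UNIV. k i) + CARD('m)" "\<And>i. s i \<in> rel_interior (P i)"
    "x = ((\<chi> i. real (Suc (k i))), \<Sum>i\<in>UNIV. real (Suc (k i)) *\<^sub>R s i)"
proof -
  obtain a s where a: "\<And>i. a i > 0" "(\<Sum>i\<in>UNIV. a i) = real t"
    and s: "\<And>i. s i \<in> rel_interior (P i)" and x: "x = ((\<chi> i. a i), \<Sum>i\<in>UNIV. a i *\<^sub>R s i)"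
    using assms(4) unfolding rel_interior_dilate_cayley_sum[OF assms(1-3)] by blast
  have "\<exists>j. a i = real (Suc j)" for i
  proof -
    have "a i \<in> \<int>"
      using assms(5) by (simp add: x lattice_points_Pair_iff lattice_points_vec_iff)
    then have "a i \<in> \<nat>"
      using a(1)[of i] by (simp add: Nats_altdef2)
    then obtain j where "a i = real j"
      by (auto elim: Nats_cases)
    then show ?thesis
      using a(1)[of i] by (cases j) auto
  qed
  then obtain k where k: "\<And>i. a i = real (Suc (k i))"
    by metis
  have "real t = real (\<Sum>i\<in>UNIV. Suc (k i))"
    using a(2) by (simp only: k of_nat_sum)
  then have "t = (\<Sum>i\<in>UNIV. k i) + CARD('m)"
    by (simp only: of_nat_eq_iff) (simp add: sum_Suc)
  then show thesis
    using s x unfolding k by (rule that)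
qed

lemma level_of_index_cayley_sum:
  fixes P :: "'m::finite \<Rightarrow> (real ^ 'n) set"
  assumes P: "\<And>i. lattice_polytope (P i)"
    and ne: "\<And>i. rel_interior (P i) \<inter> lattice_points \<noteq> {}"
    and two: "\<And>i. rel_interior (dilate 2 (P i)) = rel_interior (P i) + (P i \<inter> lattice_points)"
  shows "level_of_index (cayley_sum P) CARD('m)"
proof (rule level_of_indexI)
  have cvx: "convex (P i)" for i
    using P by (rule lattice_polytope_imp_convex)
  have nonempty: "P i \<noteq> {}" for i
    using ne[of i] rel_interior_subset by blast
  have card: "CARD('m) > 0"
    by simp
  \<comment> \<open>All weights are 1 and add up to \<open>CARD('m)\<close>. Such points give both
    an integral point at the index and the interior part of every decomposition.\<close>
  have ones: "((\<chi> i. 1), sum y UNIV) \<in> rel_interior (dilate CARD('m) (cayley_sum P))"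
    if "\<And>i. y i \<in> rel_interior (P i)" for y
    unfolding rel_interior_dilate_cayley_sum[OF cvx nonempty card] using that
    by (intro CollectI exI[of _ "\<lambda>_. 1"] exI[of _ y]) auto
  show "lattice_polytope (cayley_sum P)"
    by (rule lattice_polytope_cayley_sum[OF P])
  then have cvxC: "convex (cayley_sum P)"
    by (rule lattice_polytope_imp_convex)
  have inC: "(axis i 1, p) \<in> cayley_sum P" if "p \<in> P i" for i p
    unfolding cayley_sum_def using that by (intro hull_inc) auto
  then have neC: "cayley_sum P \<noteq> {}"
    using nonempty by blast
  show "CARD('m) > 0"
    by (rule card)
  obtain y where y: "\<And>i. y i \<in> rel_interior (P i) \<inter> lattice_points"
    using ne unfolding ex_in_conv[symmetric] by metis
  have "(\<chi> i::'m. (1::real)) \<in> lattice_points"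
    by (simp add: lattice_points_vec_iff)
  moreover have "sum y UNIV \<in> lattice_points"
    using y by (intro lattice_points_sum) blast
  ultimately have "((\<chi> i::'m. (1::real)), sum y UNIV) \<in> lattice_points"
    by (simp add: lattice_points_Pair_iff)
  then show "rel_interior (dilate CARD('m) (cayley_sum P)) \<inter> lattice_points \<noteq> {}"
    using ones[of y] y by blast
  show "CARD('m) \<le> t"
    if "t > 0" "x \<in> rel_interior (dilate t (cayley_sum P))" "x \<in> lattice_points" for t x
    using rel_interior_dilate_cayley_sum_latticeE[OF cvx nonempty that] by (metis le_add2)
  fix n x
  assume n: "CARD('m) \<le> n" and x: "x \<in> rel_interior (dilate n (cayley_sum P))" "x \<in> lattice_points"
  have "n > 0"
    using card n by linarith
  then obtain k s where k: "n = (\<Sum>i\<in>UNIV. k i) + CARD('m)" and s: "\<And>i. s i \<in> rel_interior (P i)"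
    and xs: "x = ((\<chi> i. real (Suc (k i))), \<Sum>i\<in>UNIV. real (Suc (k i)) *\<^sub>R s i)"
    using rel_interior_dilate_cayley_sum_latticeE[OF cvx nonempty _ x] by metis
  have "\<exists>y\<in>rel_interior (P i). real (Suc (k i)) *\<^sub>R s i - y \<in> dilate (k i) (P i) \<inter> lattice_points" for i
  proof (rule rel_interior_dilate_split[OF cvx two])
    show "real (Suc (k i)) *\<^sub>R s i \<in> rel_interior (dilate (Suc (k i)) (P i))"
      using s unfolding rel_interior_dilate[OF zero_less_Suc] unfolding dilate_def by blast
  qed
  then obtain y where y: "\<And>i. y i \<in> rel_interior (P i) \<and>
      real (Suc (k i)) *\<^sub>R s i - y i \<in> dilate (k i) (P i) \<and> real (Suc (k i)) *\<^sub>R s i - y i \<in> lattice_points"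
    by (metis IntE)
  define v where "v i = real (Suc (k i)) *\<^sub>R s i - y i" for i
  \<comment> \<open>Subtracting \<open>?y\<close> lowers each weight by one, from
    \<open>Suc (k i)\<close> to \<open>k i\<close>, and leaves the remainders \<open>v i\<close> in
    the second block.\<close>
  let ?y = "((\<chi> i. 1), sum y UNIV) :: (real ^ 'm) \<times> (real ^ 'n)"
  have eq: "x - ?y = ((\<chi> i. real (k i)), sum v UNIV)"
    unfolding xs v_def sum_subtractf by (simp add: vec_eq_iff)
  \<comment> \<open>The remainder is regrouped by index: the i-th part is \<open>k i\<close> times a
    point over the i-th unit vector. The factors \<open>k i\<close> add up to
    \<open>n - CARD('m)\<close>.\<close>
  have "(real (k i) *\<^sub>R axis i 1, v i) \<in> dilate (k i) (cayley_sum P)" for i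
  proof -
    obtain p where "p \<in> P i" "v i = real (k i) *\<^sub>R p"
      using y[of i] unfolding v_def[symmetric] by (auto simp: dilate_def)
    then have "(real (k i) *\<^sub>R axis i 1, v i) = real (k i) *\<^sub>R (axis i 1, p)"
      by simp
    then show ?thesis
      unfolding dilate_def using inC[OF \<open>p \<in> P i\<close>] by blast
  qed
  then have "(\<Sum>i\<in>UNIV. (real (k i) *\<^sub>R axis i 1, v i)) \<in> dilate (\<Sum>i\<in>UNIV. k i) (cayley_sum P)"
    by (intro dilate_sum cvxC neC)
  moreover have "(\<Sum>i\<in>UNIV. (real (k i) *\<^sub>R axis i 1, v i)) = x - ?y"
    unfolding eq unfolding sum_scaleR_axis[symmetric] by (simp add: prod_eq_iff fst_sum snd_sum)
  ultimately have "x - ?y \<in> dilate (n - CARD('m)) (cayley_sum P)"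
    by (simp add: k)
  moreover have "x - ?y \<in> lattice_points"
    unfolding eq lattice_points_Pair_iff
  proof
    show "(\<chi> i::'m. real (k i)) \<in> lattice_points"
      by (simp add: lattice_points_vec_iff)
    show "sum v UNIV \<in> lattice_points"
      unfolding v_def using y by (intro lattice_points_sum) blast
  qed
  moreover have "?y \<in> rel_interior (dilate CARD('m) (cayley_sum P))"
    using ones y by blast
  ultimately show "\<exists>y\<in>rel_interior (dilate CARD('m) (cayley_sum P)).
      x - y \<in> dilate (n - CARD('m)) (cayley_sum P) \<inter> lattice_points"
    by blast
qed

theorem theorem3p2:
  fixes P :: "'m::finite \<Rightarrow> (real ^ 'n) set"
  assumes "\<And>i. lattice_polytope (P i)"
    and "\<And>i. rel_interior (P i) \<inter> lattice_points \<noteq> {}"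
    and "\<And>i. rel_interior (dilate 2 (P i)) = rel_interior (P i) + (P i \<inter> lattice_points)"
  shows "level_of_index (\<Sum>i\<in>UNIV. P i) 1 \<and>
    level_of_index (cayley_sum P) CARD('m)"
  using assms by (intro conjI level_of_index_sum level_of_index_cayley_sum) auto

end
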